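(* Let $X$ be a closed and convex set in a uniformly convex normed space $(\widetilde{X},|\cdot|)$. Let $p\in X$ and $\emptyset\neq A\subset X$, and suppose that $d(p,A)>0$. Suppose also that there exists $\rho\in(0,\infty)$ such that for every $x\in X$ the open ball $B(x,\rho)$ intersects $A$, and that $p$ has the emanation property. Then $\operatorname{dom}(p,A)$ is path connected and locally path connected.
   Context: Normed spaces may be real or complex, finite or infinite dimensional; $d(x,y)=|x-y|$ is the induced metric and $d(x,A)=\inf\{d(x,a):a\in A\}$. $B(x,r)$ is the open ball of center $x$ and radius $r$. All subsets carry the topology induced by the norm. A normed space is uniformly convex if for every $\epsilon\in(0,2]$ there is $\delta\in(0,1]$ such that $|x|=|y|=1$ and $|x-y|\ge\epsilon$ imply $|(x+y)/2|\le 1-\delta$. Dominance region: for $p\in X$ and nonempty $A\subseteq X$, $\operatorname{dom}(p,A)=\{x\in X: d(x,p)\le d(x,A)\}$. Emanation property: let $\Theta_p=\{\theta:|\theta|=1,\ p+t\theta\in X\text{ for some }t>0\}$. For $\theta\in\Theta_p$ let $L(\theta)\in(0,\infty]$ be the length of the intersection of $X$ with the ray emanating from $p$ in the direction $\theta$. The point $p$ has the emanation property in the direction $\theta\in\Theta_p$ if for each $\epsilon>0$ there exists $\beta>0$ such that every $\phi\in\Theta_p$ with $|\phi-\theta|<\beta$ satisfies $L(\phi)\ge L(\theta)-\epsilon$. The point $p$ has the emanation property if it has it in the direction of every $\theta\in\Theta_p$. A topological space is locally path connected if for every point $x$ and every open $U\ni x$ there is a path connected open $V\subseteq U$ with $x\in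 V$. *)

theory Defs
  imports "HOL-Analysis.Analysis"
begin

text \<open>
  The ambient normed space is a type of class \<open>real_normed_vector\<close>. A complex normed space is
  covered through its underlying real normed space: convexity, rays, unit vectors and uniform
  convexity involve real scalars only.
\<close>

definition uniformly_convex_space :: "'a::real_normed_vector itself \<Rightarrow> bool" where
  "uniformly_convex_space _ \<longleftrightarrow>
    (\<forall>\<epsilon>::real. 0 < \<epsilon> \<and> \<epsilon> \<le> 2 \<longrightarrow>
      (\<exists>\<delta>::real. 0 < \<delta> \<and> \<delta> \<le> 1 \<and>
        (\<forall>x y :: 'a. norm x = 1 \<and> norm y = 1 \<and> norm (x - y) \<ge> \<epsilon> \<longrightarrow>
          norm ((x + y) /\<^sub>R 2) \<le> 1 - \<delta>)))"

definition dom_region :: "'a::real_normed_vector set \<Rightarrow> 'a \<Rightarrow> 'a set \<Rightarrow> 'a set" where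
  "dom_region X p A = {x \<in> X. dist x p \<le> infdist x A}"

definition ray_directions :: "'a::real_normed_vector set \<Rightarrow> 'a \<Rightarrow> 'a set" where
  "ray_directions X p = {\<theta>. norm \<theta> = 1 \<and> (\<exists>t>0. p + t *\<^sub>R \<theta> \<in> X)}"

text \<open>
  For \<open>X\<close> closed and convex, \<open>p \<in> X\<close> and a unit vector \<open>\<theta>\<close>, the part of the ray
  \<open>{p + t \<theta> | t \<ge> 0}\<close> inside \<open>X\<close> is a segment starting at \<open>p\<close> or the whole ray, and its
  length is the supremum of the admissible parameters \<open>t\<close>; see the two lemmas below.
\<close>
definition ray_length :: "'a::real_normed_vector set \<Rightarrow> 'a \<Rightarrow> 'a \<Rightarrow> ereal" where
  "ray_length X p \<theta> = (SUP t \<in> {t. 0 \<le> t \<and> p + t *\<^sub>R \<theta> \<in> X}. ereal t)"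

text \<open>
  The inequality is read in the extended reals: if \<open>ray_length X p \<theta> = \<infinity>\<close>, it requires
  \<open>ray_length X p \<phi> = \<infinity>\<close> for all admissible \<open>\<phi>\<close> close to \<open>\<theta>\<close>.
\<close>
definition emanation_property_at :: "'a::real_normed_vector set \<Rightarrow> 'a \<Rightarrow> 'a \<Rightarrow> bool" where
  "emanation_property_at X p \<theta> \<longleftrightarrow>
    (\<forall>\<epsilon>::real. \<epsilon> > 0 \<longrightarrow>
      (\<exists>\<beta>::real. \<beta> > 0 \<and>
        (\<forall>\<phi> \<in> ray_directions X p. norm (\<phi> - \<theta>) < \<beta> \<longrightarrow>
          ray_length X p \<phi> \<ge> ray_length X p \<theta> - ereal \<epsilon>)))"

definition emanation_property :: "'a::real_normed_vector set \<Rightarrow> 'a \<Rightarrow> bool" where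
  "emanation_property X p \<longleftrightarrow> (\<forall>\<theta> \<in> ray_directions X p. emanation_property_at X p \<theta>)"

lemma in_ray_downward:
  assumes "convex X" "p \<in> X" "p + t *\<^sub>R \<theta> \<in> X" "0 \<le> s" "s \<le> t"
  shows "p + s *\<^sub>R \<theta> \<in> X"
proof (cases "t = 0")
  case True
  then show ?thesis using assms by simp
next
  case False
  have "(1 - s/t) *\<^sub>R p + (s/t) *\<^sub>R (p + t *\<^sub>R \<theta>) \<in> X"
    using assms False by (intro convexD) (auto simp: field_simps)
  moreover have "(1 - s/t) *\<^sub>R p + (s/t) *\<^sub>R (p + t *\<^sub>R \<theta>) = p + s *\<^sub>R \<theta>"
    using False by (simp add: algebra_simps)
  ultimately show ?thesis by simp
qed

lemma ray_length_finite:
  assumes "closed X" "convex X" "p \<in> X" and l: "ray_length X p \<theta> = ereal l"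
  shows "{p + t *\<^sub>R \<theta> |t. 0 \<le> t} \<inter> X = closed_segment p (p + l *\<^sub>R \<theta>)"
proof -
  define T where "T = {t. 0 \<le> t \<and> p + t *\<^sub>R \<theta> \<in> X}"
  have sup: "(SUP t\<in>T. ereal t) = ereal l"
    using l by (simp add: ray_length_def T_def)
  have le: "t \<le> l" if "t \<in> T" for t
    using SUP_upper[OF that, of ereal] sup by simp
  have "0 \<in> T" using assms by (simp add: T_def)
  then have l0: "0 \<le> l" by (rule le)
  have clT: "closed T"
  proof -
    have "T = {0..} \<inter> (\<lambda>t. p + t *\<^sub>R \<theta>) -` X" by (auto simp: T_def)
    moreover have "closed ((\<lambda>t. p + t *\<^sub>R \<theta>) -` X)"
      by (intro closed_vimage assms continuous_intros)
    ultimately show ?thesis by auto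
  qed
  have bdd: "bdd_above T" unfolding bdd_above_def using le by blast
  have "Sup T \<in> T"
    using closed_contains_Sup[OF _ bdd clT] \<open>0 \<in> T\<close> by auto
  moreover have "l \<le> Sup T"
  proof -
    have "(SUP t\<in>T. ereal t) \<le> ereal (Sup T)"
      using bdd by (intro SUP_least) (auto intro: cSup_upper)
    then show ?thesis using sup by simp
  qed
  ultimately have lT: "l \<in> T" using le by force
  show ?thesis
  proof (intro set_eqI iffI)
    fix x assume "x \<in> {p + t *\<^sub>R \<theta> |t. 0 \<le> t} \<inter> X"
    then obtain t where t: "x = p + t *\<^sub>R \<theta>" "t \<in> T" by (auto simp: T_def)
    then have "0 \<le> t" "t \<le> l" using le by (auto simp: T_def)
    show "x \<in> closed_segment p (p + l *\<^sub>R \<theta>)"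
    proof (cases "l = 0")
      case True then show ?thesis using t \<open>0 \<le> t\<close> \<open>t \<le> l\<close> by simp
    next
      case False
      then show ?thesis unfolding closed_segment_def
        using t \<open>0 \<le> t\<close> \<open>t \<le> l\<close>
        by (auto intro!: exI[of _ "t/l"] simp: algebra_simps divide_le_eq)
    qed
  next
    fix x assume "x \<in> closed_segment p (p + l *\<^sub>R \<theta>)"
    then obtain u where u: "0 \<le> u" "u \<le> 1" "x = (1 - u) *\<^sub>R p + u *\<^sub>R (p + l *\<^sub>R \<theta>)"
      by (auto simp: closed_segment_def)
    have x: "x = p + (u * l) *\<^sub>R \<theta>" using u by (simp add: algebra_simps)
    have "0 \<le> u * l" "u * l \<le> l" using u l0 by (auto simp: mult_left_le_one_le)
    then have "x \<in> X"
      unfolding x using in_ray_downward[OF assms(2,3), of l] lT by (auto simp: T_def)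
    then show "x \<in> {p + t *\<^sub>R \<theta> |t. 0 \<le> t} \<inter> X" using x \<open>0 \<le> u * l\<close> by auto
  qed
qed

lemma ray_length_infinite:
  assumes "convex X" "p \<in> X" and inf: "ray_length X p \<theta> = \<infinity>"
  shows "{p + t *\<^sub>R \<theta> |t. 0 \<le> t} \<subseteq> X"
proof clarify
  fix t :: real assume "0 \<le> t"
  have "ereal t < (SUP t \<in> {t. 0 \<le> t \<and> p + t *\<^sub>R \<theta> \<in> X}. ereal t)"
    using inf by (simp add: ray_length_def)
  then obtain s where "p + s *\<^sub>R \<theta> \<in> X" "t < s"
    by (auto simp: less_SUP_iff)
  then show "p + t *\<^sub>R \<theta> \<in> X"
    using in_ray_downward[OF assms(1,2)] \<open>0 \<le> t\<close> by (meson less_imp_le)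
qed

end

theory Submission
  imports Defs
begin

text \<open>
  Since \<open>x \<mapsto> infdist x A\<close> is 1-Lipschitz, the dominance region \<open>D\<close> contains the segment from \<open>p\<close>
  to each of its points, hence is path connected. Uniform convexity makes the defining inequality
  uniformly strict on that segment away from its far end: a point of \<open>A\<close> that almost violates
  strictness is almost aligned with the segment, at the position of \<open>p\<close>, while \<open>p\<close> has positive
  distance to \<open>A\<close>. Hence, near a point \<open>x'\<close> obtained by moving \<open>x \<in> D\<close> slightly towards \<open>p\<close>, the
  region \<open>D\<close> coincides with the convex set \<open>X\<close>. A point \<open>y \<in> D\<close> close to \<open>x\<close> is therefore joined
  to \<open>x\<close> inside a small ball by moving radially to \<open>y'\<close>, straight to \<open>x'\<close>, and radially to \<open>x\<close>.
\<close>

text \<open>Near-equality in the triangle inequality forces alignment: if the direction of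
  \<open>u\<close> were far from \<open>\<theta>\<close>, adding equal multiples of both would lose
  a fixed amount of length. The gain \<open>\<eta>\<close> is uniform in \<open>u\<close> and
  \<open>\<theta>\<close>.\<close>

lemma uniformly_convex_nearly_additive:
  assumes "uniformly_convex_space TYPE('a::real_normed_vector)"
    and "0 < s" "0 < t" "0 < \<epsilon>"
  obtains \<eta> where "0 < \<eta>"
    "\<And>u \<theta> :: 'a. \<lbrakk>norm \<theta> = 1; norm u < t + \<eta>; t + s \<le> norm (u + s *\<^sub>R \<theta>)\<rbrakk>
      \<Longrightarrow> norm (u - t *\<^sub>R \<theta>) < \<epsilon>"
proof -
  \<comment> \<open>The modulus is available only up to 2, hence the cap. Half of
    \<open>\<epsilon>\<close> pays for the error in direction, \<open>t * \<epsilon>'\<close>; the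
    other half pays for the error in length, \<open>norm u - t < \<eta>\<close>.\<close>
  define \<epsilon>' where "\<epsilon>' = min 2 (\<epsilon> / (2 * t))"
  have "0 < \<epsilon>'" "\<epsilon>' \<le> 2" and t\<epsilon>': "t * \<epsilon>' \<le> \<epsilon> / 2"
    using assms by (auto simp: \<epsilon>'_def min_def field_simps)
  then obtain \<delta> where \<delta>: "0 < \<delta>"
    "\<And>v w :: 'a. \<lbrakk>norm v = 1; norm w = 1; \<epsilon>' \<le> norm (v - w)\<rbrakk>
      \<Longrightarrow> norm ((v + w) /\<^sub>R 2) \<le> 1 - \<delta>"
    using assms(1) unfolding uniformly_convex_space_def by metis
  define \<eta> where "\<eta> = min (\<epsilon> / 2) (2 * \<delta> * min t s)"
  have "0 < \<eta>" using assms \<delta> by (simp add: \<eta>_def)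
  moreover have "norm (u - t *\<^sub>R \<theta>) < \<epsilon>"
    if \<theta>: "norm \<theta> = 1" and u: "norm u < t + \<eta>" and long: "t + s \<le> norm (u + s *\<^sub>R \<theta>)"
    for u \<theta> :: 'a
  proof -
    have "norm (u + s *\<^sub>R \<theta>) \<le> norm u + s"
      using norm_triangle_ineq[of u "s *\<^sub>R \<theta>"] \<theta> assms by simp
    then have tu: "t \<le> norm u" using long by simp
    define v where "v = u /\<^sub>R norm u"
    have v: "norm v = 1" and uv: "u = norm u *\<^sub>R v"
    proof -
      have "norm u \<noteq> 0" using tu \<open>0 < t\<close> by linarith
      then show "norm v = 1" "u = norm u *\<^sub>R v" by (simp_all add: v_def)
    qed
    have close: "norm (v - \<theta>) < \<epsilon>'"
    proof (rule ccontr)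
      assume "\<not> norm (v - \<theta>) < \<epsilon>'"
      then have "norm ((v + \<theta>) /\<^sub>R 2) \<le> 1 - \<delta>" using \<delta>(2) v \<theta> by simp
      then have mid: "norm (v + \<theta>) \<le> 2 - 2 * \<delta>" by simp
      define m where "m = min (norm u) s"
      have m: "0 < m" "m \<le> norm u" "m \<le> s" "min t s \<le> m"
        using tu assms by (auto simp: m_def)
      \<comment> \<open>The midpoint bound applies to equal multiples of \<open>v\<close> and
        \<open>\<theta>\<close> only, so the largest common multiple \<open>m\<close> is split off.
        It saves at least \<open>2 * \<delta> * m\<close>, and \<open>min t s \<le> m\<close> makes
        this saving independent of \<open>u\<close>.\<close>
      have "u + s *\<^sub>R \<theta> = (norm u - m) *\<^sub>R v + ((s - m) *\<^sub>R \<theta> + m *\<^sub>R (v + \<theta>))"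
        by (subst uv) (simp add: algebra_simps)
      also have "norm \<dots> \<le> (norm u - m) + ((s - m) + m * norm (v + \<theta>))"
        by (rule norm_triangle_le, rule add_mono, use m v in simp,
            rule norm_triangle_le, use m \<theta> in simp)
      also have "m * norm (v + \<theta>) \<le> m * (2 - 2 * \<delta>)"
        using mid m by (intro mult_left_mono) auto
      finally have "2 * \<delta> * m \<le> norm u - t" using long by (simp add: algebra_simps)
      moreover have "2 * \<delta> * min t s \<le> 2 * \<delta> * m" using m \<delta> by (intro mult_left_mono) auto
      ultimately show False using u by (simp add: \<eta>_def)
    qed
    have "u - t *\<^sub>R \<theta> = (norm u - t) *\<^sub>R v + t *\<^sub>R (v - \<theta>)"
      by (subst uv) (simp add: algebra_simps)
    also have "norm \<dots> \<le> (norm u - t) + t * norm (v - \<theta>)"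
      by (rule norm_triangle_le) (use tu v assms in simp)
    also have "\<dots> < \<eta> + t * \<epsilon>'"
      using u close assms by (intro add_strict_mono mult_strict_left_mono) auto
    also have "\<dots> \<le> \<epsilon>" using t\<epsilon>' by (simp add: \<eta>_def)
    finally show ?thesis .
  qed
  ultimately show ?thesis by (rule that)
qed

text \<open>Moving from \<open>x\<close> to \<open>y\<close> lowers the distance to \<open>p\<close>
  by exactly \<open>dist x y\<close>, and the distance to \<open>A\<close> by at most that
  much.\<close>

lemma closed_segment_subset_dom_region:
  assumes "convex X" "p \<in> X" "x \<in> dom_region X p A"
  shows "closed_segment p x \<subseteq> dom_region X p A"
proof
  fix y assume y: "y \<in> closed_segment p x"
  have "x \<in> X" "dist x p \<le> infdist x A" using assms by (auto simp: dom_region_def)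
  moreover have "dist x p = dist x y + dist y p"
  proof -
    obtain c where c: "0 \<le> c" "c \<le> 1" and yc: "y = (1 - c) *\<^sub>R p + c *\<^sub>R x"
      using y by (auto simp: in_segment)
    have "x - y = (1 - c) *\<^sub>R (x - p)" "y - p = c *\<^sub>R (x - p)"
      by (simp_all add: yc algebra_simps)
    then have "dist x y = (1 - c) * dist x p" "dist y p = c * dist x p"
      using c by (simp_all only: dist_norm norm_scaleR abs_of_nonneg diff_ge_0_iff_ge)
    then show ?thesis by (simp add: algebra_simps)
  qed
  moreover have "infdist x A \<le> infdist y A + dist x y" by (rule infdist_triangle)
  moreover have "y \<in> X"
    using closed_segment_subset[OF \<open>p \<in> X\<close> \<open>x \<in> X\<close> \<open>convex X\<close>] y by blast
  ultimately show "y \<in> dom_region X p A" by (simp add: dom_region_def)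
qed

text \<open>If some \<open>a\<close> in \<open>A\<close> were almost as close to the intermediate
  point as \<open>p\<close> is, the detour from \<open>x\<close> through that point to
  \<open>a\<close> would be barely longer than \<open>dist x p \<le> dist x a\<close>.
  Near-additivity then puts \<open>a\<close> closer to \<open>p\<close> than
  \<open>infdist p A\<close>.\<close>

lemma dist_less_infdist_dom_region:
  fixes p x :: "'a::real_normed_vector"
  assumes "uniformly_convex_space TYPE('a)"
    and "A \<noteq> {}" and "0 < infdist p A" and "x \<in> dom_region X p A"
    and "0 < c" "c < 1"
  shows "dist (p + c *\<^sub>R (x - p)) p < infdist (p + c *\<^sub>R (x - p)) A"
proof (cases "x = p")
  case True
  then show ?thesis using assms by simp
next
  case False
  define T where "T = norm (x - p)"
  define \<theta> where "\<theta> = (x - p) /\<^sub>R T"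
  define x' where "x' = p + c *\<^sub>R (x - p)"
  have T: "0 < T" and \<theta>: "norm \<theta> = 1" and xp: "x - p = T *\<^sub>R \<theta>"
    using False by (auto simp: T_def \<theta>_def)
  have pos: "0 < (1 - c) * T" "0 < c * T" using T assms by auto
  obtain \<eta> where \<eta>: "0 < \<eta>"
    "\<And>u. \<lbrakk>norm u < c * T + \<eta>; c * T + (1 - c) * T \<le> norm (u + ((1 - c) * T) *\<^sub>R \<theta>)\<rbrakk>
      \<Longrightarrow> norm (u - (c * T) *\<^sub>R \<theta>) < infdist p A"
    using uniformly_convex_nearly_additive[OF assms(1) pos assms(3)] \<theta> by metis
  \<comment> \<open>A uniform gap is needed, since the infimum over \<open>A\<close> may not be
    attained.\<close>
  have "c * T + \<eta> \<le> infdist x' A"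
  proof (rule ccontr)
    assume "\<not> c * T + \<eta> \<le> infdist x' A"
    then obtain a where a: "a \<in> A" "dist x' a < c * T + \<eta>"
      using \<open>A \<noteq> {}\<close> by (auto simp: infdist_notempty not_le cINF_less_iff)
    have x': "x' = p + (c * T) *\<^sub>R \<theta>" by (simp add: x'_def xp)
    have x: "x = x' + ((1 - c) * T) *\<^sub>R \<theta>"
      using xp by (simp add: x' algebra_simps)
    have "T \<le> infdist x A"
      using assms(4) by (simp add: dom_region_def T_def dist_norm)
    also have "\<dots> \<le> dist x a" using a by (intro infdist_le)
    finally have "c * T + (1 - c) * T \<le> norm (x' - a + ((1 - c) * T) *\<^sub>R \<theta>)"
      by (simp add: x dist_norm algebra_simps)
    \<comment> \<open>Here \<open>u = x' - a\<close>, and subtracting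
      \<open>(c * T) *\<^sub>R \<theta>\<close> leaves \<open>p - a\<close>.\<close>
    then have "norm (x' - a - (c * T) *\<^sub>R \<theta>) < infdist p A"
      using a by (intro \<eta>(2)) (auto simp: dist_norm)
    then have "dist p a < infdist p A" by (simp add: x' dist_norm algebra_simps)
    with infdist_le[OF a(1), of p] show False by simp
  qed
  moreover have "dist x' p = c * T" using assms by (simp add: x'_def dist_norm T_def)
  ultimately show ?thesis using \<open>0 < \<eta>\<close> by (simp add: x'_def)
qed

lemma path_connected_dom_region:
  assumes "convex X" "p \<in> X"
  shows "path_connected (dom_region X p A)"
proof -
  have "p \<in> dom_region X p A" using assms by (simp add: dom_region_def infdist_nonneg)
  then show ?thesis
    using closed_segment_subset_dom_region[OF assms]
    by (intro starlike_imp_path_connected) (auto simp: starlike_def)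
qed

lemma locally_path_connected_dom_region:
  fixes p :: "'a::real_normed_vector"
  assumes uc: "uniformly_convex_space TYPE('a)"
    and X: "convex X" "p \<in> X" and A: "A \<noteq> {}" "0 < infdist p A"
  shows "locally path_connected (dom_region X p A)"
proof -
  let ?D = "dom_region X p A"
  \<comment> \<open>The neighbourhood \<open>u\<close> itself need not be path connected: this
    weaker condition, required at every point, already gives local path connectedness.\<close>
  have "\<exists>u. openin (top_of_set ?D) u \<and> x \<in> u \<and> u \<subseteq> w \<and>
          (\<forall>y\<in>u. \<exists>g. path g \<and> path_image g \<subseteq> w \<and> pathstart g = x \<and> pathfinish g = y)"
    if "openin (top_of_set ?D) w" "x \<in> w" for w x
  proof -
    from that have xD: "x \<in> ?D" using openin_imp_subset by blast
    from that obtain e where e: "0 < e" "ball x e \<inter> ?D \<subseteq> w"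
      unfolding openin_contains_ball by blast
    \<comment> \<open>The bound 1/2 keeps \<open>c\<close> positive; the summand 1 covers
      \<open>x = p\<close> and makes the displacement strictly less than
      \<open>e / 2\<close>.\<close>
    define c where "c = 1 - min (1/2) (e / (2 * (norm (x - p) + 1)))"
    have c: "0 < c" "c < 1" using e by (auto simp: c_def min_def add_nonneg_pos)
    have "(1 - c) * norm (x - p) \<le> e / (2 * (norm (x - p) + 1)) * norm (x - p)"
      by (intro mult_right_mono) (auto simp: c_def)
    also have "\<dots> < e / 2"
      using e by (simp add: field_simps add_pos_nonneg)
    finally have ce: "(1 - c) * norm (x - p) < e / 2" .
    \<comment> \<open>A homothety with centre \<open>p\<close> and ratio \<open>c < 1\<close>: it
      contracts distances, so it carries \<open>ball x r\<close> into
      \<open>ball (q x) r\<close>.\<close>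
    define q where "q y = p + c *\<^sub>R (y - p)" for y
    have dq: "dist (q x) x < e / 2"
    proof -
      have "q x - x = - ((1 - c) *\<^sub>R (x - p))" by (simp add: q_def algebra_simps)
      then show ?thesis using ce c by (simp add: dist_norm)
    qed
    have "open {z. dist z p < infdist z A}"
      by (intro open_Collect_less continuous_intros)
    moreover have "dist (q x) p < infdist (q x) A"
      unfolding q_def by (rule dist_less_infdist_dom_region[OF uc A xD c])
    ultimately obtain r' where r': "0 < r'" "ball (q x) r' \<subseteq> {z. dist z p < infdist z A}"
      by (metis (no_types, lifting) mem_Collect_eq openE)
    \<comment> \<open>Below \<open>r'\<close>, membership in \<open>X\<close> suffices for
      \<open>?D\<close>; below \<open>e / 2\<close>, the ball around \<open>q x\<close> stays inside
      \<open>ball x e\<close>.\<close>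
    define r where "r = min r' (e / 2)"
    have r: "0 < r" "r \<le> e / 2" using r' e by (auto simp: r_def)
    have D: "ball (q x) r \<inter> X \<subseteq> ?D" using r'(2) by (auto simp: r_def dom_region_def)
    have B: "ball (q x) r \<subseteq> ball x e"
    proof
      fix z assume "z \<in> ball (q x) r"
      then show "z \<in> ball x e"
        using dq r dist_triangle[of x z "q x"] by (simp add: dist_commute)
    qed
    have radial: "closed_segment y (q y) \<subseteq> w" and qX: "q y \<in> ball (q x) r \<inter> X"
      if y: "y \<in> ball x r \<inter> ?D" for y
    proof -
      have "q y \<in> closed_segment p y"
        using c by (auto simp: q_def in_segment algebra_simps intro!: exI[of _ c])
      then have seg: "closed_segment y (q y) \<subseteq> ?D" "q y \<in> ?D"
        using closed_segment_subset_dom_region[OF X, of y A] y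
          subset_closed_segment[of y "q y" p y] by auto
      have "dist (q x) (q y) = c * dist x y"
        using c by (simp add: q_def dist_norm flip: scaleR_diff_right)
      also have "\<dots> \<le> dist x y" using c by (simp add: mult_left_le_one_le)
      finally have qr: "q y \<in> ball (q x) r" using y by simp
      then show "q y \<in> ball (q x) r \<inter> X" using seg by (simp add: dom_region_def)
      have "y \<in> ball x e" "q y \<in> ball x e" using y r e qr B by auto
      then have "closed_segment y (q y) \<subseteq> ball x e"
        by (intro closed_segment_subset) auto
      then show "closed_segment y (q y) \<subseteq> w" using seg e by blast
    qed
    have cross: "closed_segment (q x) (q y) \<subseteq> w" if y: "y \<in> ball x r \<inter> ?D" for y
    proof -
      have "closed_segment (q x) (q y) \<subseteq> ball (q x) r \<inter> X"
        using qX[OF y] qX[of x] xD r X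
        by (intro closed_segment_subset convex_Int) auto
      then show ?thesis using B D e by blast
    qed
    have "\<exists>g. path g \<and> path_image g \<subseteq> w \<and> pathstart g = x \<and> pathfinish g = y"
      if y: "y \<in> ball x r \<inter> ?D" for y
    proof -
      \<comment> \<open>Only the middle piece leaves the rays from \<open>p\<close>; it stays in the
        convex set \<open>ball (q x) r \<inter> X\<close>.\<close>
      let ?g = "linepath x (q x) +++ linepath (q x) (q y) +++ linepath (q y) y"
      have "path_image ?g \<subseteq> w"
        using radial[of x] radial[OF y] cross[OF y] xD r
        by (intro subset_path_image_join) (auto simp: closed_segment_commute)
      then show ?thesis by (intro exI[of _ ?g]) auto
    qed
    moreover have "openin (top_of_set ?D) (ball x r \<inter> ?D)"
      by (metis inf_commute open_ball openin_open_Int)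
    moreover have "ball x r \<inter> ?D \<subseteq> w" using e r by auto
    ultimately show ?thesis using xD r
      by (intro exI[of _ "ball x r \<inter> ?D"]) auto
  qed
  then show ?thesis
    unfolding locally_path_connected_im_kleinen Ball_def by simp
qed

theorem lemma5p2:
  fixes X A :: "'a::real_normed_vector set" and p :: 'a
  assumes "uniformly_convex_space TYPE('a)"
    and "closed X" and "convex X"
    and "p \<in> X" and "A \<noteq> {}" and "A \<subseteq> X"
    and "infdist p A > 0"
    and "\<exists>\<rho>::real. \<rho> > 0 \<and> (\<forall>x\<in>X. ball x \<rho> \<inter> A \<noteq> {})"
    and "emanation_property X p"
  shows "path_connected (dom_region X p A) \<and> locally path_connected (dom_region X p A)"
  using assms by (simp add: path_connected_dom_region locally_path_connected_dom_region)

end
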